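(* Let $n\ge 4$, let $D$ be a simple drawing of the complete graph $K_n$ in the sphere $\mathbb S^2$, and let $C$ be the simple closed curve bounding a face of $D$. If $e_1,e_2,e_3$ are distinct open edges (arcs without their end vertices) incident with a common vertex $v$, then at least one of $C\cap e_1$, $C\cap e_2$, and $C\cap e_3$ is empty.
   Context: Drawing: in a drawing $D$ of $K_n$ in the sphere $\mathbb S^2$, each vertex is represented by a distinct point of $\mathbb S^2$, and each edge is represented by an arc joining the points representing its two incident vertices. No edge contains a vertex-point in its interior, and any two edge-arcs have finitely many intersections, all of which are either common endpoints or crossings. More than two edges are allowed to cross at the same point. Vertices and edges are identified with the points and arcs representing them, and $D[K_n]$ denotes the union of all these points and arcs. Simple drawing: a drawing is simple if any two distinct closed edges have at most one point in common, this point being either a vertex (common endpoint) or a crossing. Face: a face of $D$ is a connected component of $\mathbb S^2\setminus D[K_n]$. It is a known fact that, for $n\ge 3$, each face of a simple drawing of $K_n$ is an open disc whose closure is a closed disc, so its boundary is a simple closed curve. An open edge is incident with $v$ if $v$ is one of the two end vertices of the corresponding edge of $K_n$. *)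

theory Defs
  imports "HOL-Analysis.Analysis"
begin

abbreviation S2 :: "(real^3) set" where
  "S2 \<equiv> sphere 0 1"

text \<open>The vertices of \<open>K\<^sub>n\<close> are \<open>0, \<dots>, n - 1\<close>; an edge is a two-element set of vertices.\<close>

definition K_edges :: "nat \<Rightarrow> nat set set" where
  "K_edges n = {a. a \<subseteq> {..<n} \<and> card a = 2}"

text \<open>
  Two arcs \<open>A\<close>, \<open>B\<close> cross at \<open>x\<close> if, up to a homeomorphism of a neighbourhood of \<open>x\<close> in the
  sphere onto the plane, they look like the two coordinate axes at the origin. In
  particular \<open>x\<close> is then an endpoint of neither arc, and tangential contact is excluded.
\<close>

definition crosses_at :: "(real^3) set \<Rightarrow> (real^3) set \<Rightarrow> real^3 \<Rightarrow> bool" where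
  "crosses_at A B x \<longleftrightarrow>
     (\<exists>U h k. openin (top_of_set S2) U \<and> x \<in> U \<and>
        homeomorphism U (UNIV :: complex set) h k \<and> h x = 0 \<and>
        h ` (A \<inter> U) = {z. Im z = 0} \<and> h ` (B \<inter> U) = {z. Re z = 0})"

text \<open>
  A drawing is given by the placement \<open>p\<close> of the vertices and by the function \<open>E\<close> that assigns
  to each edge its closed arc, as a point set. Thus \<open>p ` a\<close> is the set of end vertices of
  the arc \<open>E a\<close>.
\<close>

definition open_edge :: "(nat \<Rightarrow> real^3) \<Rightarrow> (nat set \<Rightarrow> (real^3) set) \<Rightarrow> nat set \<Rightarrow> (real^3) set" where
  "open_edge p E a = E a - p ` a"

locale drawing =
  fixes n :: nat and p :: "nat \<Rightarrow> real^3" and E :: "nat set \<Rightarrow> (real^3) set"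
  assumes vertices_distinct: "inj_on p {..<n}"
    and vertices_on_sphere: "p ` {..<n} \<subseteq> S2"
    and edges_on_sphere: "a \<in> K_edges n \<Longrightarrow> E a \<subseteq> S2"
    and edge_arc: "\<lbrakk>i < n; j < n; i \<noteq> j\<rbrakk> \<Longrightarrow>
      \<exists>g. arc g \<and> pathstart g = p i \<and> pathfinish g = p j \<and> path_image g = E {i, j}"
    and no_vertex_inside: "a \<in> K_edges n \<Longrightarrow> open_edge p E a \<inter> p ` {..<n} = {}"
    and finite_intersection: "\<lbrakk>a \<in> K_edges n; b \<in> K_edges n; a \<noteq> b\<rbrakk> \<Longrightarrow> finite (E a \<inter> E b)"
    and intersection_kind: "\<lbrakk>a \<in> K_edges n; b \<in> K_edges n; a \<noteq> b; x \<in> E a \<inter> E b\<rbrakk> \<Longrightarrow>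
      x \<in> p ` a \<inter> p ` b \<or> crosses_at (E a) (E b) x"

locale simple_drawing = drawing +
  assumes at_most_one_common_point:
    "\<lbrakk>a \<in> K_edges n; b \<in> K_edges n; a \<noteq> b; x \<in> E a \<inter> E b; y \<in> E a \<inter> E b\<rbrakk> \<Longrightarrow> x = y"

definition drawing_set :: "nat \<Rightarrow> (nat \<Rightarrow> real^3) \<Rightarrow> (nat set \<Rightarrow> (real^3) set) \<Rightarrow> (real^3) set" where
  "drawing_set n p E = p ` {..<n} \<union> (\<Union>a\<in>K_edges n. E a)"

definition faces :: "nat \<Rightarrow> (nat \<Rightarrow> real^3) \<Rightarrow> (nat set \<Rightarrow> (real^3) set) \<Rightarrow> (real^3) set set" where
  "faces n p E = components (S2 - drawing_set n p E)"

text \<open>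
  The boundary is taken relative to the sphere: in the ambient space, a face has empty
  interior, so its frontier there would be its whole closure.
\<close>

definition face_boundary :: "(real^3) set \<Rightarrow> (real^3) set" where
  "face_boundary F = (top_of_set S2) frontier_of F"

definition open_edges_at ::
    "nat \<Rightarrow> (nat \<Rightarrow> real^3) \<Rightarrow> (nat set \<Rightarrow> (real^3) set) \<Rightarrow> nat \<Rightarrow> (real^3) set set" where
  "open_edges_at n p E v = open_edge p E ` {a \<in> K_edges n. v \<in> a}"

end

theory Submission imports Defs
begin

text \<open>
  Suppose a face touches the three open edges \<open>va\<close>, \<open>vb\<close>, \<open>vc\<close>. It is contained in a face \<open>G\<close> of the
  subdrawing induced by \<open>v\<close>, \<open>a\<close>, \<open>b\<close>, \<open>c\<close>, and \<open>G\<close> touches the three edges as well. So it suffices to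
  treat the complete graph on these four vertices.

  The topological core is the theta lemma \<open>spherical_theta_faces_touch_two_arcs\<close>: if three arcs with
  common endpoints (the poles) are otherwise disjoint, then no connected set in their complement
  touches the interiors of all three. It follows from the Jordan curve theorem and Janiszewski's
  theorem after a stereographic projection. It remains to find, in the drawing of the four-vertex
  graph, a theta graph whose three arcs contain the three contact points.

  Adjacent edges share only their common vertex, so only the opposite pairs \<open>va, bc\<close> and \<open>vb, ca\<close>
  and \<open>vc, ab\<close> can meet otherwise, each in at most one point. Two of the three pairs are alike: both
  disjoint, or both meeting. By symmetry let these be the first two.

  \<^item> If both are disjoint, the paths \<open>v a c\<close>, \<open>v b c\<close> and \<open>v c\<close> form the theta graph.
  \<^item> If \<open>va\<close> meets \<open>bc\<close> at \<open>x\<close>, the paths \<open>v x\<close>, \<open>v b x\<close> and \<open>v c x\<close> form a theta graph, so \<open>G\<close> does not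
    touch \<open>va\<close> strictly between \<open>v\<close> and \<open>x\<close>. Likewise, if \<open>vb\<close> meets \<open>ca\<close> at \<open>y\<close>, \<open>G\<close> does not touch
    \<open>vb\<close> strictly between \<open>v\<close> and \<open>y\<close>. Now the paths \<open>x a y\<close>, \<open>x b y\<close> and \<open>x c v y\<close> form a theta graph
    as required.

  For the last theta graph the contact points must differ from the poles \<open>x\<close> and \<open>y\<close>. This can be
  arranged because the edges cross there: a face touching a crossing also touches both crossing
  edges at nearby points (\<open>crossing_point_touches_arc_elsewhere\<close>).
\<close>

section \<open>Arcs as point sets\<close>

text \<open>
  Arcs are cut at crossings and joined again into new arcs. Only the point sets and their
  endpoints matter for this, so the parametrisation is hidden.
\<close>
definition arc_between :: "'a::topological_space set \<Rightarrow> 'a \<Rightarrow> 'a \<Rightarrow> bool" where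
  "arc_between A s t \<longleftrightarrow>
     (\<exists>g. arc g \<and> pathstart g = s \<and> pathfinish g = t \<and> path_image g = A)"

lemma arc_between_sym: "arc_between A s t \<Longrightarrow> arc_between A t s"
  unfolding arc_between_def
  by (metis arc_reversepath path_image_reversepath pathfinish_reversepath pathstart_reversepath)

lemma arc_between_ends:
  assumes "arc_between A s t"
  shows "s \<in> A" "t \<in> A" "s \<noteq> t"
  using assms unfolding arc_between_def
  by (auto dest: arc_distinct_ends)

lemma arc_between_compact: "arc_between A s t \<Longrightarrow> compact A"
  unfolding arc_between_def by (metis compact_arc_image)

lemma arc_between_connected: "arc_between A s t \<Longrightarrow> connected A"
  unfolding arc_between_def by (metis connected_arc_image)

lemma arc_between_endless_connected:
  "arc_between A s t \<Longrightarrow> connected (A - {s, t})"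
  unfolding arc_between_def by (metis arc_imp_simple_path connected_simple_path_endless)

lemma arc_between_join:
  assumes "arc_between A s m" "arc_between B m t" "A \<inter> B = {m}"
  shows "arc_between (A \<union> B) s t"
proof -
  obtain f g where "arc f" "pathstart f = s" "pathfinish f = m" "path_image f = A"
    and "arc g" "pathstart g = m" "pathfinish g = t" "path_image g = B"
    using assms unfolding arc_between_def by blast
  then have "arc (f +++ g)" "path_image (f +++ g) = A \<union> B" "pathstart (f +++ g) = s"
    "pathfinish (f +++ g) = t"
    using assms(3) by (simp_all add: arc_join path_image_join)
  then show ?thesis unfolding arc_between_def by blast
qed

lemma arc_between_split:
  fixes A :: "'a::real_normed_vector set"
  assumes "arc_between A s t" "x \<in> A" "x \<noteq> s" "x \<noteq> t"
  obtains A1 A2 where "arc_between A1 s x" "arc_between A2 x t" "A = A1 \<union> A2" "A1 \<inter> A2 = {x}"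
proof -
  obtain g where g: "arc g" "pathstart g = s" "pathfinish g = t" "path_image g = A"
    using assms unfolding arc_between_def by blast
  then obtain u where u: "u \<in> {0..1}" "g u = x"
    using assms(2) by (auto simp: path_image_def)
  have g01: "g 0 = s" "g 1 = t" using g(2,3) by (auto simp: pathstart_def pathfinish_def)
  have u01: "u \<noteq> 0" "u \<noteq> 1"
    using u g assms by (auto simp: pathstart_def pathfinish_def)
  have inj: "inj_on g {0..1}" using g(1) by (rule arc_imp_inj_on)
  have "{0..u} \<inter> {u..1} = {u}" using u by auto
  then have "g ` {0..u} \<inter> g ` {u..1} = {x}"
    using inj_on_image_Int[OF inj, of "{0..u}" "{u..1}"] u by auto
  moreover have "A = g ` {0..u} \<union> g ` {u..1}"
  proof -
    have "{0..u} \<union> {u..1} = {0..1}" using u by auto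
    then show ?thesis using g(4) by (simp add: path_image_def flip: image_Un)
  qed
  moreover have "arc_between (g ` {0..u}) s x"
    unfolding arc_between_def
    using arc_subpath_arc[OF g(1), of 0 u] u u01 g
    by (intro exI[of _ "subpath 0 u g"]) (auto simp: path_image_subpath g01)
  moreover have "arc_between (g ` {u..1}) x t"
    unfolding arc_between_def
    using arc_subpath_arc[OF g(1), of u 1] u u01 g
    by (intro exI[of _ "subpath u 1 g"]) (auto simp: path_image_subpath g01)
  ultimately show thesis using that by blast
qed

lemma arc_between_image:
  assumes "arc_between A s t" "continuous_on A f" "inj_on f A"
  shows "arc_between (f ` A) (f s) (f t)"
proof -
  obtain g where g: "arc g" "pathstart g = s" "pathfinish g = t" "path_image g = A"
    using assms unfolding arc_between_def by blast
  have "arc (f \<circ> g)"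
    using g assms(2,3) unfolding arc_def path_def path_image_def
    by (metis comp_inj_on continuous_on_compose)
  then show ?thesis
    unfolding arc_between_def using g
    by (intro exI[of _ "f \<circ> g"]) (auto simp: pathstart_compose pathfinish_compose path_image_compose)
qed

lemma arc_between_interior_nonempty:
  assumes "arc_between A s t"
  shows "A - {s, t} \<noteq> {}"
proof -
  obtain g where g: "arc g" "pathstart g = s" "pathfinish g = t" "path_image g = A"
    using assms unfolding arc_between_def by blast
  have inj: "inj_on g {0..1}" using g(1) by (rule arc_imp_inj_on)
  have "g (1/2) \<noteq> g 0" "g (1/2) \<noteq> g 1"
    using inj by (auto simp: inj_on_eq_iff)
  moreover have "g (1/2) \<in> A" using g(4) by (auto simp: path_image_def)
  ultimately show ?thesis using g(2,3) by (auto simp: pathstart_def pathfinish_def)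
qed

section \<open>Theta graphs in the plane\<close>

lemma arc_between_loop:
  assumes "arc_between A s t" "arc_between B s t" "A \<inter> B = {s, t}"
  obtains c where "simple_path c" "pathfinish c = pathstart c" "path_image c = A \<union> B"
proof -
  obtain f where f: "arc f" "pathstart f = s" "pathfinish f = t" "path_image f = A"
    using assms unfolding arc_between_def by blast
  obtain g where g: "arc g" "pathstart g = t" "pathfinish g = s" "path_image g = B"
    using arc_between_sym[OF assms(2)] unfolding arc_between_def by blast
  show thesis
  proof (rule that)
    show "simple_path (f +++ g)"
      using f g assms(3) by (intro simple_path_join_loop) auto
  qed (use f g in \<open>auto simp: path_image_join\<close>)
qed

lemma Jordan_two_arcs:
  fixes A B :: "complex set"
  assumes "arc_between A s t" "arc_between B s t" "A \<inter> B = {s, t}"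
  shows "inside (A \<union> B) \<noteq> {}" "open (inside (A \<union> B))" "connected (inside (A \<union> B))"
    "connected (outside (A \<union> B))" "inside (A \<union> B) \<inter> outside (A \<union> B) = {}"
    "inside (A \<union> B) \<union> outside (A \<union> B) = - (A \<union> B)"
    "frontier (inside (A \<union> B)) = A \<union> B" "bounded (inside (A \<union> B))"
proof -
  obtain c where c: "simple_path c" "pathfinish c = pathstart c" "path_image c = A \<union> B"
    using arc_between_loop[OF assms] .
  from Jordan_inside_outside[OF c(1,2)]
  show "inside (A \<union> B) \<noteq> {}" "open (inside (A \<union> B))" "connected (inside (A \<union> B))"
    "connected (outside (A \<union> B))" "inside (A \<union> B) \<inter> outside (A \<union> B) = {}"
    "inside (A \<union> B) \<union> outside (A \<union> B) = - (A \<union> B)"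
    "frontier (inside (A \<union> B)) = A \<union> B" "bounded (inside (A \<union> B))"
    unfolding c(3) by auto
qed

lemma connected_subset_inside:
  fixes K :: "'a::real_normed_vector set"
  assumes "closed K" "connected S" "S \<inter> K = {}" "S \<inter> inside K \<noteq> {}"
  shows "S \<subseteq> inside K"
proof -
  have "S \<subseteq> inside K \<union> outside K" using assms(3) by (auto simp: inside_Un_outside)
  moreover have "S \<inter> outside K = {}"
    using connectedD[OF assms(2), of "inside K" "outside K"] assms calculation
    by (auto simp: open_inside open_outside inside_Int_outside)
  ultimately show ?thesis by blast
qed

text \<open>
  In a planar theta graph one of the three arcs runs inside the closed curve formed by the other
  two. Otherwise each of the three cycles would have an inside free of the third arc. These
  insides would be pairwise disjoint, since two that meet are equal and then have equal
  frontiers. So a point \<open>u\<close> inside \<open>B \<union> C\<close> would be separated from the point \<open>w\<close>, which is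
  outside everything, neither by \<open>A \<union> B\<close> nor by \<open>A \<union> C\<close>. As these two curves share the connected
  set \<open>A\<close>, Janiszewski's theorem says that their union, the whole theta graph, does not
  separate the two points either; but \<open>B \<union> C\<close> does. The point \<open>w\<close> stands for the outer face.
\<close>
lemma planar_theta_has_inner_arc:
  fixes A B C :: "complex set"
  assumes arcs: "arc_between A s t" "arc_between B s t" "arc_between C s t"
    and meet: "A \<inter> B = {s, t}" "A \<inter> C = {s, t}" "B \<inter> C = {s, t}"
    and outer: "C - {s, t} \<subseteq> outside (A \<union> B)" "B - {s, t} \<subseteq> outside (A \<union> C)"
      "A - {s, t} \<subseteq> outside (B \<union> C)"
    and w: "w \<in> outside (A \<union> B)" "w \<in> outside (A \<union> C)" "w \<in> outside (B \<union> C)"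
  shows False
proof -
  have clo: "closed A" "closed B" "closed C"
    using arcs by (auto intro: compact_imp_closed arc_between_compact)
  \<comment> \<open>Usable for \<open>K\<close> a cycle and \<open>N\<close> the remaining arc: the inside of \<open>K\<close> misses the whole theta graph.\<close>
  have avoid: "inside K \<inter> N = {}" if "N - {s, t} \<subseteq> outside K" "{s, t} \<subseteq> K" for K N :: "complex set"
  proof -
    have "N \<subseteq> outside K \<union> K" using that by blast
    then show ?thesis using inside_Int_outside[of K] inside_no_overlap[of K] by blast
  qed
  have distinct_inside: "inside (L \<union> M) \<inter> inside (M \<union> N) = {}"
    if "arc_between L s t" "arc_between M s t" "arc_between N s t"
      "L \<inter> M = {s,t}" "M \<inter> N = {s,t}"
      "N - {s,t} \<subseteq> outside (L \<union> M)" "L - {s,t} \<subseteq> outside (M \<union> N)" for L M N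
  proof (rule ccontr)
    assume ne: "inside (L \<union> M) \<inter> inside (M \<union> N) \<noteq> {}"
    note J1 = Jordan_two_arcs[OF that(1,2,4)] and J2 = Jordan_two_arcs[OF that(2,3,5)]
    have clos: "closed (L \<union> M)" "closed (M \<union> N)"
      using that by (auto intro: compact_imp_closed arc_between_compact)
    have "inside (L \<union> M) \<inter> (M \<union> N) = {}" "inside (M \<union> N) \<inter> (L \<union> M) = {}"
      using avoid[OF that(6)] avoid[OF that(7)] that(4,5)
        inside_no_overlap[of "L \<union> M"] inside_no_overlap[of "M \<union> N"]
      by blast+
    then have "inside (L \<union> M) = inside (M \<union> N)"
      using connected_subset_inside[OF clos(2) J1(3)] connected_subset_inside[OF clos(1) J2(3)] ne
      by (simp add: Int_commute subset_antisym)
    then have "L \<union> M = M \<union> N" by (metis J1(7) J2(7))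
    then show False
      using that(6) J1(6) arc_between_interior_nonempty[OF that(3)] by blast
  qed
  obtain u where u: "u \<in> inside (B \<union> C)"
    using Jordan_two_arcs(1)[OF arcs(2,3) meet(3)] by blast
  have uBC: "u \<notin> A \<union> B \<union> C"
    using u avoid[OF outer(3)] meet(3) inside_no_overlap[of "B \<union> C"] by blast
  have "u \<notin> inside (A \<union> B)"
    using distinct_inside[OF arcs meet(1,3) outer(1,3)] u by blast
  then have uAB: "u \<in> outside (A \<union> B)"
    using Jordan_two_arcs(6)[OF arcs(1,2) meet(1)] uBC by blast
  have "inside (A \<union> C) \<inter> inside (C \<union> B) = {}"
    using distinct_inside[OF arcs(1,3,2) meet(2)] outer meet by (simp add: Un_commute Int_commute)
  then have "u \<notin> inside (A \<union> C)"
    using u by (auto simp: Un_commute[of C B])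
  then have uAC: "u \<in> outside (A \<union> C)"
    using Jordan_two_arcs(6)[OF arcs(1,3) meet(2)] uBC by blast
  have "connected_component (- ((A \<union> B) \<union> (A \<union> C))) u w"
  proof (rule Janiszewski)
    have "(A \<union> B) \<inter> (A \<union> C) = A" using meet arc_between_ends[OF arcs(1)] by blast
    then show "connected ((A \<union> B) \<inter> (A \<union> C))" using arc_between_connected[OF arcs(1)] by simp
    show "connected_component (- (A \<union> B)) u w"
      unfolding connected_component_def
      using uAB w Jordan_two_arcs(4,6)[OF arcs(1,2) meet(1)] by blast
    show "connected_component (- (A \<union> C)) u w"
      unfolding connected_component_def
      using uAC w Jordan_two_arcs(4,6)[OF arcs(1,3) meet(2)] by blast
  qed (use arcs clo in \<open>auto intro: arc_between_compact\<close>)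
  then obtain T where T: "connected T" "T \<subseteq> - ((A \<union> B) \<union> (A \<union> C))" "u \<in> T" "w \<in> T"
    unfolding connected_component_def by blast
  have "T \<subseteq> inside (B \<union> C)"
    using T u clo by (intro connected_subset_inside) auto
  then show False
    using w(3) T(4) Jordan_two_arcs(5)[OF arcs(2,3) meet(3)] by blast
qed

section \<open>Theta graphs on the sphere\<close>

lemma stereographic_projection:
  fixes q :: "real^3"
  assumes "q \<in> S2"
  obtains h k where "homeomorphism (S2 - {q}) (UNIV :: complex set) h k"
proof -
  have "(S2 - {q}) homeomorphic {x::real^3. q \<bullet> x = 0}"
    using assms by (intro homeomorphic_punctured_sphere_hyperplane) auto
  also have "{x::real^3. q \<bullet> x = 0} homeomorphic (UNIV :: complex set)"
  proof (intro homeomorphic_affine_sets)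
    have "q \<noteq> 0" using assms by auto
    then show "aff_dim {x::real^3. q \<bullet> x = 0} = aff_dim (UNIV :: complex set)"
      by (subst aff_dim_hyperplane) auto
  qed (auto simp: affine_hyperplane)
  finally show thesis using that unfolding homeomorphic_def by blast
qed

text \<open>
  Project stereographically from a point of \<open>F\<close>. Then \<open>F\<close> lies outside each of the three cycles,
  because it is connected and contains infinity. An arc that is touched by \<open>F\<close> therefore does not
  enter the inside of the cycle formed by the other two. In the plane this cannot hold for all three arcs.
\<close>
lemma spherical_theta_faces_touch_two_arcs:
  fixes A B C F :: "(real^3) set"
  assumes arcs: "arc_between A s t" "arc_between B s t" "arc_between C s t"
    and sub: "A \<subseteq> S2" "B \<subseteq> S2" "C \<subseteq> S2"
    and meet: "A \<inter> B = {s, t}" "A \<inter> C = {s, t}" "B \<inter> C = {s, t}"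
    and F: "F \<subseteq> S2" "connected F" "F \<inter> (A \<union> B \<union> C) = {}"
    and P: "P \<in> closure F" "P \<in> A - {s, t}"
    and Q: "Q \<in> closure F" "Q \<in> B - {s, t}"
    and R: "R \<in> closure F" "R \<in> C - {s, t}"
  shows False
proof -
  obtain q where q: "q \<in> F" using P(1) by fastforce
  have "F \<noteq> {q}" using P F(3) q by auto
  then obtain w where w: "w \<in> F" "w \<noteq> q" using q by blast
  obtain h k where hom: "homeomorphism (S2 - {q}) (UNIV :: complex set) h k"
    using stereographic_projection q F(1) by blast
  have kh: "k (h x) = x" if "x \<in> S2" "x \<noteq> q" for x
    using hom that by (auto simp: homeomorphism_def)
  have conth: "continuous_on (S2 - {q}) h" and contk: "continuous_on UNIV k"
    using hom by (auto simp: homeomorphism_def)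
  have kS: "k z \<in> S2 - {q}" for z using hom unfolding homeomorphism_def by blast
  have injh: "inj_on h (S2 - {q})" by (rule inj_on_inverseI[of _ k]) (auto simp: kh)
  have subq: "L \<subseteq> S2 - {q}" if "L \<in> {A, B, C}" for L using that sub F(3) q by auto
  have arch: "arc_between (h ` L) (h s) (h t)" if "L \<in> {A, B, C}" "arc_between L s t" for L
    using that subq[of L] by (intro arc_between_image) (auto intro: continuous_on_subset[OF conth] inj_on_subset[OF injh])
  have meeth: "h ` L \<inter> h ` M = {h s, h t}" if "L \<in> {A, B, C}" "M \<in> {A, B, C}" "L \<inter> M = {s, t}" for L M
    using inj_on_image_Int[OF injh subq[OF that(1)] subq[OF that(2)]] that(3) by auto
  \<comment> \<open>One cycle \<open>L \<union> M\<close> at a time, with \<open>N\<close> the remaining arc and \<open>X\<close> a point where \<open>F\<close> touches it.\<close>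
  have side: "h w \<in> outside (h ` L \<union> h ` M) \<and> h ` N - {h s, h t} \<subseteq> outside (h ` L \<union> h ` M)"
    if mem: "L \<in> {A, B, C}" "M \<in> {A, B, C}" "N \<in> {A, B, C}"
      and ar: "arc_between L s t" "arc_between M s t" "arc_between N s t"
      and mt: "L \<inter> M = {s, t}" "L \<inter> N = {s, t}" "M \<inter> N = {s, t}"
      and X: "X \<in> closure F" "X \<in> N - {s, t}" for L M N X
  proof -
    define I where "I = inside (h ` L \<union> h ` M)"
    note J = Jordan_two_arcs[OF arch[OF mem(1) ar(1)] arch[OF mem(2) ar(2)] meeth[OF mem(1,2) mt(1)]]
    have "openin (top_of_set (S2 - {q})) (k ` I)"
      using J(2) homeomorphism_imp_open_map[OF homeomorphism_sym[THEN iffD1, OF hom], of I]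
      unfolding I_def by auto
    then have opI: "openin (top_of_set S2) (k ` I)"
      by (rule openin_trans) (simp add: openin_delete)
    have "k ` h ` L = L" "k ` h ` M = M"
      using subq[OF mem(1)] subq[OF mem(2)] kh by force+
    then have clI: "k ` closure I = k ` I \<union> (L \<union> M)"
      unfolding I_def closure_Un_frontier J(7) by (simp add: image_Un)
    \<comment> \<open>The part of \<open>F\<close> inside the cycle is open in \<open>F\<close>, and closed since \<open>F\<close> avoids the cycle. It
      does not contain \<open>q\<close>, so it is empty.\<close>
    have "compact (k ` closure I)"
      using J(8) unfolding I_def
      by (intro compact_continuous_image continuous_on_subset[OF contk]) auto
    then have "closedin (top_of_set F) (F \<inter> k ` closure I)"
      by (intro closedin_closed_Int compact_imp_closed)
    moreover have "F \<inter> k ` closure I = F \<inter> k ` I"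
      using clI F(3) mem by auto
    moreover have "openin (top_of_set F) (F \<inter> k ` I)"
      using opI F(1) by (auto simp: openin_open)
    moreover have "q \<notin> k ` I" using kS by auto
    ultimately have FI: "F \<inter> k ` I = {}"
      using F(2) q unfolding connected_clopen by (metis IntD2)
    have "h w \<notin> I" using FI w kh F(1) by (metis disjoint_iff image_eqI subsetD)
    moreover have "h w \<notin> h ` L \<union> h ` M"
    proof -
      have "w \<in> S2 - {q}" "w \<notin> L" "w \<notin> M" using w F(1,3) mem by auto
      then show ?thesis
        using inj_on_image_mem_iff[OF injh _ subq[OF mem(1)]] inj_on_image_mem_iff[OF injh _ subq[OF mem(2)]]
        by blast
    qed
    ultimately have 1: "h w \<in> outside (h ` L \<union> h ` M)"
      using J(6) unfolding I_def by blast
    have disj: "(h ` N - {h s, h t}) \<inter> (h ` L \<union> h ` M) = {}"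
      using meeth[OF mem(1,3) mt(2)] meeth[OF mem(2,3) mt(3)] by blast
    \<comment> \<open>If \<open>N\<close> entered the inside, it would stay there, and near \<open>X\<close> so would points of \<open>F\<close>.\<close>
    have "(h ` N - {h s, h t}) \<inter> I = {}"
    proof (rule ccontr)
      assume ne: "(h ` N - {h s, h t}) \<inter> I \<noteq> {}"
      have "h ` N - {h s, h t} \<subseteq> I"
        unfolding I_def
      proof (rule connected_subset_inside)
        show "closed (h ` L \<union> h ` M)"
          using arch mem ar by (blast intro: compact_imp_closed arc_between_compact)
        show "connected (h ` N - {h s, h t})"
          using arch mem ar by (blast intro: arc_between_endless_connected)
      qed (use disj ne I_def in auto)
      moreover have "h X \<in> h ` N - {h s, h t}"
        using X(2) subq[OF mem(3)] arc_between_ends[OF ar(3)] injh by (auto simp: inj_on_def)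
      ultimately have "h X \<in> I" by blast
      then have "X \<in> k ` I" using kh X(2) subq[OF mem(3)] by (metis DiffE image_eqI insertCI subsetD)
      moreover obtain O' where "open O'" "k ` I = S2 \<inter> O'" using opI by (auto simp: openin_open)
      ultimately have "O' \<inter> F = {}" "X \<in> O'" using FI F(1) by blast+
      then show False
        using X(1) open_Int_closure_eq_empty[OF \<open>open O'\<close>, of F] by blast
    qed
    then have "h ` N - {h s, h t} \<subseteq> - (h ` L \<union> h ` M) - I" using disj by blast
    also have "\<dots> \<subseteq> outside (h ` L \<union> h ` M)"
      unfolding J(6)[symmetric] I_def by blast
    finally show ?thesis using 1 by blast
  qed
  have m: "A \<in> {A, B, C}" "B \<in> {A, B, C}" "C \<in> {A, B, C}" by auto
  have meet': "B \<inter> A = {s, t}" "C \<inter> A = {s, t}" "C \<inter> B = {s, t}" using meet by auto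
  show False
    using planar_theta_has_inner_arc[OF arch[OF m(1) arcs(1)] arch[OF m(2) arcs(2)] arch[OF m(3) arcs(3)]
        meeth[OF m(1,2) meet(1)] meeth[OF m(1,3) meet(2)] meeth[OF m(2,3) meet(3)], of "h w"]
      side[OF m(1,2,3) arcs meet R] side[OF m(1,3,2) arcs(1,3,2) meet(2,1) meet'(3) Q]
      side[OF m(2,3,1) arcs(2,3,1) meet(3) meet'(1,2) P]
    by blast
qed

section \<open>Three spokes of a complete graph on four vertices\<close>

lemma Int_eq_singleton_mono:
  "A \<inter> B = {x} \<Longrightarrow> A' \<subseteq> A \<Longrightarrow> B' \<subseteq> B \<Longrightarrow> x \<in> A' \<Longrightarrow> x \<in> B' \<Longrightarrow> A' \<inter> B' = {x}"
  by blast

lemma Int_eq_singleton_avoid: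
  "A \<inter> B = {x} \<Longrightarrow> A' \<subseteq> A \<Longrightarrow> B' \<subseteq> B \<Longrightarrow> x \<notin> A' \<or> x \<notin> B' \<Longrightarrow> A' \<inter> B' = {}"
  by (auto simp: set_eq_iff)

text \<open>
  Let \<open>x\<close> be the point where the spoke from \<open>v\<close> that starts with \<open>A1\<close> meets the opposite edge \<open>X\<close>
  from \<open>b\<close> to \<open>c\<close>. There are three ways to go from \<open>v\<close> to \<open>x\<close>: along \<open>A1\<close>, by way of \<open>b\<close>, and by
  way of \<open>c\<close>. They form a theta graph, so a face that touches the open edges \<open>B\<close> and \<open>C\<close> does
  not touch the interior of \<open>A1\<close>.
\<close>
lemma face_misses_first_half_of_crossed_spoke:
  fixes A1 B C X F :: "(real^3) set"
  assumes arcs: "arc_between A1 v x" "arc_between B v b" "arc_between C v c" "arc_between X b c"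
    and sub: "A1 \<subseteq> S2" "B \<subseteq> S2" "C \<subseteq> S2" "X \<subseteq> S2"
    and meet: "A1 \<inter> B = {v}" "A1 \<inter> C = {v}" "B \<inter> C = {v}" "A1 \<inter> X = {x}" "B \<inter> X = {b}" "C \<inter> X = {c}"
    and F: "F \<subseteq> S2" "connected F" "F \<inter> (A1 \<union> B \<union> C \<union> X) = {}"
    and P: "P \<in> closure F" "P \<in> A1 - {v, x}"
    and Q: "Q \<in> closure F" "Q \<in> B - {v, b}"
    and R: "R \<in> closure F" "R \<in> C - {v, c}"
  shows False
proof -
  have "x \<noteq> v" "x \<in> A1" using arc_between_ends[OF arcs(1)] by auto
  then have "x \<in> X" "x \<notin> B" "x \<notin> C" using meet(1,2,4) by blast+
  then have x: "x \<in> X" "x \<notin> B" "x \<notin> C" "x \<noteq> b" "x \<noteq> c"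
    using arc_between_ends(2)[OF arcs(2)] arc_between_ends(2)[OF arcs(3)] by auto
  obtain X1 X2 where X: "arc_between X1 b x" "arc_between X2 x c" "X = X1 \<union> X2" "X1 \<inter> X2 = {x}"
    using arc_between_split[OF arcs(4) x(1) x(4,5)] .
  note Xends = arc_between_ends[OF X(1)] arc_between_ends[OF X(2)]
  have c1: "c \<notin> X1" "b \<notin> X2" using X(4) Xends x(4,5) by auto
  have m: "B \<inter> X1 = {b}" "C \<inter> X2 = {c}" "A1 \<inter> X1 = {x}" "A1 \<inter> X2 = {x}" "C \<inter> X1 = {}" "B \<inter> X2 = {}"
    using meet(4-6) X(3) Xends c1 by auto
  show False
  proof (rule spherical_theta_faces_touch_two_arcs[where A = A1 and B = "B \<union> X1" and C = "C \<union> X2"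
        and s = v and t = x and F = F and P = P and Q = Q and R = R])
    show "arc_between (B \<union> X1) v x" using arcs(2) X(1) m(1) by (rule arc_between_join)
    show "arc_between (C \<union> X2) v x"
      using arcs(3) arc_between_sym[OF X(2)] m(2) by (rule arc_between_join)
    show "A1 \<inter> (B \<union> X1) = {v, x}" using meet m by auto
    show "A1 \<inter> (C \<union> X2) = {v, x}" using meet m by auto
    show "(B \<union> X1) \<inter> (C \<union> X2) = {v, x}" using meet(3) m X(4)
      by (simp add: Int_Un_distrib Int_Un_distrib2 Int_commute insert_commute)
  qed (use assms X(3) x in auto)
qed

text \<open>
  Here \<open>v\<close> is joined to \<open>a\<close>, \<open>b\<close>, \<open>c\<close> by the spokes \<open>A\<close>, \<open>B\<close>, \<open>C\<close>, and \<open>X\<close> and \<open>Y\<close> are the edges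
  opposite to \<open>A\<close> and \<open>B\<close>. A suitable theta graph has its three arcs touched by \<open>F\<close>:

  \<^item> If neither \<open>A\<close> nor \<open>B\<close> meets its opposite edge, take the three ways from \<open>v\<close> to \<open>c\<close>: by way of
    \<open>a\<close>, by way of \<open>b\<close>, and direct.
  \<^item> If both do, at \<open>x\<close> and \<open>y\<close>, then \<open>F\<close> can touch \<open>A\<close> only beyond \<open>x\<close> and \<open>B\<close> only beyond \<open>y\<close>, by the
    preceding lemma. The three ways from \<open>x\<close> to \<open>y\<close> by way of \<open>a\<close>, of \<open>b\<close>, and of first \<open>c\<close> and
    then \<open>v\<close> contain these two pieces and all of \<open>C\<close>.

  Touching a pole of a theta graph says nothing about its open arcs; hence \<open>P\<close> and \<open>Q\<close> are kept
  off the opposite edges, so that \<open>P \<noteq> x\<close> and \<open>Q \<noteq> y\<close>.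
\<close>
lemma K4_face_misses_a_spoke:
  fixes A B C X Y F :: "(real^3) set"
  assumes arcs: "arc_between A v a" "arc_between B v b" "arc_between C v c"
      "arc_between X b c" "arc_between Y a c"
    and sub: "A \<subseteq> S2" "B \<subseteq> S2" "C \<subseteq> S2" "X \<subseteq> S2" "Y \<subseteq> S2"
    and spokes: "A \<inter> B = {v}" "A \<inter> C = {v}" "B \<inter> C = {v}"
    and adjacent: "A \<inter> Y = {a}" "B \<inter> X = {b}" "C \<inter> X = {c}" "C \<inter> Y = {c}" "X \<inter> Y = {c}"
    and opposite: "A \<inter> X = {} \<and> B \<inter> Y = {} \<or> (\<exists>x y. A \<inter> X = {x} \<and> B \<inter> Y = {y})"
    and F: "F \<subseteq> S2" "connected F" "F \<inter> (A \<union> B \<union> C \<union> X \<union> Y) = {}"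
    and P: "P \<in> closure F" "P \<in> A - {v, a}" "P \<notin> X"
    and Q: "Q \<in> closure F" "Q \<in> B - {v, b}" "Q \<notin> Y"
    and R: "R \<in> closure F" "R \<in> C - {v, c}"
  shows False
  using opposite
proof (elim disjE exE conjE)
  assume opp: "A \<inter> X = {}" "B \<inter> Y = {}"
  show False
  proof (rule spherical_theta_faces_touch_two_arcs[where A = "A \<union> Y" and B = "B \<union> X" and C = C
        and s = v and t = c and F = F and P = P and Q = Q and R = R])
    show "arc_between (A \<union> Y) v c" using arcs(1,5) adjacent(1) by (rule arc_between_join)
    show "arc_between (B \<union> X) v c" using arcs(2,4) adjacent(2) by (rule arc_between_join)
    show "(A \<union> Y) \<inter> (B \<union> X) = {v, c}" "(A \<union> Y) \<inter> C = {v, c}" "(B \<union> X) \<inter> C = {v, c}"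
      using spokes adjacent opp by auto
    show "P \<in> A \<union> Y - {v, c}"
      using P adjacent arc_between_ends[OF arcs(4)] by auto
    show "Q \<in> B \<union> X - {v, c}"
      using Q adjacent arc_between_ends[OF arcs(5)] by auto
  qed (use arcs sub F P Q R in auto)
next
  fix x y
  assume opp: "A \<inter> X = {x}" "B \<inter> Y = {y}"
  note ends = arcs[THEN arc_between_ends(1)] arcs[THEN arc_between_ends(2)] arcs[THEN arc_between_ends(3)]
  have "v \<notin> X" "a \<notin> X" "b \<notin> A" "c \<notin> A" "v \<notin> Y" "b \<notin> Y" "a \<notin> B" "c \<notin> B"
  proof -
    show "v \<notin> X" using ends adjacent(2) by auto
    show "a \<notin> X" using ends adjacent(5) by auto
    show "b \<notin> A" using ends spokes(1) by auto
    show "c \<notin> A" using ends spokes(2) by auto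
    show "v \<notin> Y" using ends adjacent(1) by auto
    show "b \<notin> Y" using ends adjacent(5) by auto
    show "a \<notin> B" using ends spokes(1) by auto
    show "c \<notin> B" using ends spokes(3) by auto
  qed
  then have x: "x \<in> A" "x \<in> X" "x \<noteq> v" "x \<noteq> a" "x \<noteq> b" "x \<noteq> c"
    and y: "y \<in> B" "y \<in> Y" "y \<noteq> v" "y \<noteq> b" "y \<noteq> a" "y \<noteq> c"
    using opp by auto
  obtain A1 A2 where A: "arc_between A1 v x" "arc_between A2 x a" "A = A1 \<union> A2" "A1 \<inter> A2 = {x}"
    using arc_between_split[OF arcs(1) x(1) x(3,4)] .
  obtain B1 B2 where B: "arc_between B1 v y" "arc_between B2 y b" "B = B1 \<union> B2" "B1 \<inter> B2 = {y}"
    using arc_between_split[OF arcs(2) y(1) y(3,4)] .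
  obtain X1 X2 where X: "arc_between X1 b x" "arc_between X2 x c" "X = X1 \<union> X2" "X1 \<inter> X2 = {x}"
    using arc_between_split[OF arcs(4) x(2) x(5,6)] .
  obtain Y1 Y2 where Y: "arc_between Y1 a y" "arc_between Y2 y c" "Y = Y1 \<union> Y2" "Y1 \<inter> Y2 = {y}"
    using arc_between_split[OF arcs(5) y(2) y(5,6)] .
  note Ae = arc_between_ends[OF A(1)] arc_between_ends[OF A(2)]
  note Be = arc_between_ends[OF B(1)] arc_between_ends[OF B(2)]
  note Xe = arc_between_ends[OF X(1)] arc_between_ends[OF X(2)]
  note Ye = arc_between_ends[OF Y(1)] arc_between_ends[OF Y(2)]
  have "P \<notin> A1"
  proof
    assume "P \<in> A1"
    then have "P \<in> A1 - {v, x}" using P x by auto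
    moreover have "A1 \<inter> B = {v}" "A1 \<inter> C = {v}" "A1 \<inter> X = {x}"
      using spokes(1,2) opp(1) A(3) Ae by auto
    ultimately show False
      using face_misses_first_half_of_crossed_spoke[OF A(1) arcs(2,3,4) _ sub(2-4) _ _ spokes(3) _ adjacent(2,3) F(1,2) _ P(1) _ Q(1,2) R]
        A(3) sub(1) F(3) by auto
  qed
  then have P2: "P \<in> A2" using P A by auto
  have "Q \<notin> B1"
  proof
    assume "Q \<in> B1"
    then have "Q \<in> B1 - {v, y}" using Q y by auto
    moreover have "B1 \<inter> A = {v}" "B1 \<inter> C = {v}" "B1 \<inter> Y = {y}"
      using spokes(1,3) opp(2) B(3) Be by auto
    ultimately show False
      using face_misses_first_half_of_crossed_spoke[OF B(1) arcs(1,3,5) _ sub(1,3,5) _ _ spokes(2) _ adjacent(1,4) F(1,2) _ Q(1) _ P(1,2) R]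
        B(3) sub(2) F(3) by auto
  qed
  then have Q2: "Q \<in> B2" using Q B by auto
  have off: "v \<notin> A2" "v \<notin> B2" "b \<notin> B1" "b \<notin> X2" "c \<notin> X1" "c \<notin> Y1"
    using A(4) B(4) X(4) Y(4) Ae Be Xe Ye x y by auto
  have part: "A2 \<subseteq> A" "B1 \<subseteq> B" "B2 \<subseteq> B" "X1 \<subseteq> X" "X2 \<subseteq> X" "Y1 \<subseteq> Y"
    using A(3) B(3) X(3) Y(3) by auto
  have join1: "A2 \<inter> Y1 = {a}"
    by (rule Int_eq_singleton_mono[OF adjacent(1)]) (use part Ae Ye in auto)
  have join2: "B2 \<inter> X1 = {b}"
    by (rule Int_eq_singleton_mono[OF adjacent(2)]) (use part Be Xe in auto)
  have join3: "C \<inter> X2 = {c}"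
    by (rule Int_eq_singleton_mono[OF adjacent(3)]) (use part Xe ends in auto)
  have join4: "B1 \<inter> C = {v}"
    by (rule Int_eq_singleton_mono[OF spokes(3)]) (use part Be ends in auto)
  have join5: "B1 \<inter> X2 = {}"
    by (rule Int_eq_singleton_avoid[OF adjacent(2)]) (use part off in auto)
  have "arc_between (X2 \<union> C) x v"
    using X(2) arc_between_sym[OF arcs(3)] join3[unfolded Int_commute[of C]] by (rule arc_between_join)
  then have arc3: "arc_between (X2 \<union> C \<union> B1) x y"
    using B(1) by (rule arc_between_join) (use join4 join5 in \<open>simp add: Int_Un_distrib Int_Un_distrib2 Int_commute\<close>)
  show False
  proof (rule spherical_theta_faces_touch_two_arcs[where A = "A2 \<union> Y1" and B = "X1 \<union> B2" and C = "X2 \<union> C \<union> B1"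
        and s = x and t = y and F = F and P = P and Q = Q and R = R])
    show "arc_between (A2 \<union> Y1) x y" using A(2) Y(1) join1 by (rule arc_between_join)
    show "arc_between (X1 \<union> B2) x y"
      using arc_between_sym[OF X(1)] arc_between_sym[OF B(2)] join2[unfolded Int_commute[of B2]] by (rule arc_between_join)
    show "arc_between (X2 \<union> C \<union> B1) x y" by (rule arc3)
    have AX: "A2 \<inter> X1 = {x}" "A2 \<inter> X2 = {x}"
      by (rule Int_eq_singleton_mono[OF opp(1)]; use part Ae Xe in auto)+
    have BY: "B1 \<inter> Y1 = {y}" "B2 \<inter> Y1 = {y}"
      by (rule Int_eq_singleton_mono[OF opp(2)]; use part Be Ye in auto)+
    have AB: "A2 \<inter> B1 = {}" "A2 \<inter> B2 = {}"
      by (rule Int_eq_singleton_avoid[OF spokes(1)]; use part off in auto)+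
    have AC: "A2 \<inter> C = {}"
      by (rule Int_eq_singleton_avoid[OF spokes(2)]; use part off in auto)
    have BC: "B2 \<inter> C = {}"
      by (rule Int_eq_singleton_avoid[OF spokes(3)]; use part off in auto)
    have BX: "B1 \<inter> X1 = {}" "B2 \<inter> X2 = {}"
      by (rule Int_eq_singleton_avoid[OF adjacent(2)]; use part off in auto)+
    have CX: "C \<inter> X1 = {}"
      by (rule Int_eq_singleton_avoid[OF adjacent(3)]; use part off in auto)
    have CY: "C \<inter> Y1 = {}"
      by (rule Int_eq_singleton_avoid[OF adjacent(4)]; use part off in auto)
    have XY: "X1 \<inter> Y1 = {}" "X2 \<inter> Y1 = {}"
      by (rule Int_eq_singleton_avoid[OF adjacent(5)]; use part off in auto)+
    note pieces = AX BY AB AC BC BX CX CY XY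
    show "(A2 \<union> Y1) \<inter> (X1 \<union> B2) = {x, y}"
      using pieces by (simp add: Int_Un_distrib Int_Un_distrib2 insert_commute Int_commute)
    show "(A2 \<union> Y1) \<inter> (X2 \<union> C \<union> B1) = {x, y}"
      using pieces by (simp add: Int_Un_distrib Int_Un_distrib2 insert_commute Int_commute)
    show "(X1 \<union> B2) \<inter> (X2 \<union> C \<union> B1) = {x, y}"
      using pieces X(4) B(4) by (simp add: Int_Un_distrib Int_Un_distrib2 insert_commute Int_commute)
    show "P \<in> A2 \<union> Y1 - {x, y}" using P2 P(3) P(2) x y spokes(1) by auto
    show "Q \<in> X1 \<union> B2 - {x, y}" using Q2 Q(3) Q(2) x y spokes(1) by auto
    show "R \<in> X2 \<union> C \<union> B1 - {x, y}" using R(2) x y spokes(2,3) by auto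
  qed (use sub F P Q R A(3) B(3) X(3) Y(3) in auto)
qed

section \<open>Moving a contact off a crossing\<close>

text \<open>
  As \<open>x\<close> has a neighbourhood disjoint from \<open>T\<close>, in the coordinates given by the crossing the
  complement of \<open>A \<union> X \<union> T\<close> consists near \<open>x\<close> of four open quadrants. A face with \<open>x\<close> in its closure has a point \<open>z\<close> in one of them. The
  vertical segment from \<open>z\<close> to the horizontal axis, which represents \<open>A\<close>, stays in that quadrant
  until it ends at a point of \<open>A\<close> other than \<open>x\<close>, which is thus also in the closure of the face.
\<close>
lemma crossing_point_touches_arc_elsewhere:
  assumes cross: "crosses_at A X x" and T: "closed T" "x \<notin> T"
    and F: "F \<in> components (S2 - (A \<union> X \<union> T))" and x: "x \<in> closure F"
  obtains y where "y \<in> closure F" "y \<in> A" "y \<notin> X" "y \<notin> T"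
proof -
  obtain U h k where U: "openin (top_of_set S2) U" "x \<in> U"
    and hom: "homeomorphism U (UNIV :: complex set) h k" and hx: "h x = 0"
    and hA: "h ` (A \<inter> U) = {z. Im z = 0}" and hX: "h ` (X \<inter> U) = {z. Re z = 0}"
    using cross unfolding crosses_at_def by blast
  have kh: "k (h u) = u" if "u \<in> U" for u using hom that unfolding homeomorphism_def by blast
  have hk: "h (k z) = z" for z using hom unfolding homeomorphism_def by blast
  have kU: "k z \<in> U" for z using hom unfolding homeomorphism_def by blast
  have contk: "continuous_on UNIV k" using hom unfolding homeomorphism_def by blast
  have kA: "k z \<in> A \<longleftrightarrow> Im z = 0" for z
  proof -
    have "k z \<in> A \<longleftrightarrow> z \<in> h ` (A \<inter> U)" using kU hk kh by (metis IntD1 IntD2 IntI imageE image_eqI)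
    then show ?thesis using hA by simp
  qed
  have kX: "k z \<in> X \<longleftrightarrow> Re z = 0" for z
  proof -
    have "k z \<in> X \<longleftrightarrow> z \<in> h ` (X \<inter> U)" using kU hk kh by (metis IntD1 IntD2 IntI imageE image_eqI)
    then show ?thesis using hX by simp
  qed
  have "open (k -` (- T))" using contk T by (intro open_vimage) auto
  moreover have "0 \<in> k -` (- T)" using T kh[OF U(2)] hx by auto
  ultimately obtain r where r: "r > 0" "ball 0 r \<subseteq> k -` (- T)"
    using open_contains_ball by blast
  have "openin (top_of_set U) (k ` ball 0 r)"
    using homeomorphism_imp_open_map[OF homeomorphism_sym[THEN iffD1, OF hom], of "ball 0 r"] by auto
  then have "openin (top_of_set S2) (k ` ball 0 r)" using U(1) openin_trans by blast
  then obtain V where V: "open V" "k ` ball 0 r = S2 \<inter> V" by (auto simp: openin_open)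
  have "x \<in> k ` ball 0 r" using kh[OF U(2)] hx r by force
  then have "V \<inter> F \<noteq> {}" using open_Int_closure_eq_empty[OF V(1), of F] x V(2) by blast
  then obtain f where f: "f \<in> F" "f \<in> V" by blast
  have FS: "F \<subseteq> S2 - (A \<union> X \<union> T)" using F by (rule in_components_subset)
  then have "f \<in> k ` ball 0 r" using f V(2) by blast
  then obtain z where z: "z \<in> ball 0 r" "f = k z" by blast
  have zne: "Re z \<noteq> 0" "Im z \<noteq> 0" using f FS z kA kX by blast+
  define g where "g = (\<lambda>t. k (Complex (Re z) (t * Im z)))"
  have contg: "continuous_on UNIV g"
    unfolding g_def Complex_eq
    by (intro continuous_on_compose2[OF contk]) (auto intro!: continuous_intros)
  have inball: "Complex (Re z) (t * Im z) \<in> ball 0 r" if "0 \<le> t" "t \<le> 1" for t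
  proof -
    have "(t * Im z)\<^sup>2 \<le> (Im z)\<^sup>2"
      using that by (simp add: power_mult_distrib mult_left_le_one_le power_le_one)
    then have "norm (Complex (Re z) (t * Im z)) \<le> norm z"
      by (simp add: cmod_def)
    then show ?thesis using z by simp
  qed
  have "g ` {0<..1} \<subseteq> F"
  proof (rule components_maximal[OF F])
    show "connected (g ` {0<..1})"
      by (rule connected_continuous_image) (auto intro: continuous_on_subset[OF contg])
    show "g ` {0<..1} \<subseteq> S2 - (A \<union> X \<union> T)"
    proof clarify
      fix t :: real assume t: "t \<in> {0<..1}"
      then have "Complex (Re z) (t * Im z) \<in> ball 0 r" by (intro inball) auto
      then have "g t \<in> S2" "g t \<notin> T" unfolding g_def using V(2) r(2) by blast+
      moreover have "g t \<notin> A" "g t \<notin> X" unfolding g_def kA kX using t zne by auto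
      ultimately show "g t \<in> S2 - (A \<union> X \<union> T)" by blast
    qed
    have "g 1 = f" using z by (simp add: g_def)
    then show "F \<inter> g ` {0<..1} \<noteq> {}" using f by force
  qed
  then have "closure (g ` {0<..1}) \<subseteq> closure F" by (rule closure_mono)
  moreover have "g ` closure {0<..1} \<subseteq> closure (g ` {0<..1})"
    by (intro image_closure_subset) (auto intro: continuous_on_subset[OF contg] closure_subset[THEN subsetD])
  moreover have "0 \<in> closure {0<..1::real}" by (simp add: closure_greaterThanAtMost)
  ultimately have "g 0 \<in> closure F" by blast
  moreover have "g 0 \<in> A" "g 0 \<notin> X" unfolding g_def kA kX using zne by auto
  moreover have "g 0 \<notin> T" unfolding g_def using inball[of 0] r(2) by auto
  ultimately show thesis by (rule that)
qed

section \<open>Complete subgraphs on four vertices of a simple drawing\<close>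

context simple_drawing
begin

lemma edge_arc_between:
  "i < n \<Longrightarrow> j < n \<Longrightarrow> i \<noteq> j \<Longrightarrow> arc_between (E {i, j}) (p i) (p j)"
  using edge_arc unfolding arc_between_def by blast

lemma edge_in_K: "i < n \<Longrightarrow> j < n \<Longrightarrow> i \<noteq> j \<Longrightarrow> {i, j} \<in> K_edges n"
  unfolding K_edges_def by auto

lemma adjacent_edges_meet:
  assumes "i < n" "j < n" "k < n" "i \<noteq> j" "i \<noteq> k" "j \<noteq> k"
  shows "E {i, j} \<inter> E {i, k} = {p i}"
proof -
  have "p i \<in> E {i, j} \<inter> E {i, k}"
    using assms edge_arc_between arc_between_ends by (meson IntI)
  moreover have "{i, j} \<noteq> {i, k}" using assms by (auto simp: doubleton_eq_iff)
  ultimately show ?thesis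
    using at_most_one_common_point[of "{i, j}" "{i, k}"] edge_in_K assms by blast
qed

lemma edges_meet_at_most_once:
  assumes "a \<in> K_edges n" "b \<in> K_edges n" "a \<noteq> b"
  shows "E a \<inter> E b = {} \<or> (\<exists>x. E a \<inter> E b = {x})"
  using at_most_one_common_point[OF assms] by blast

lemma face_touches_edge_off_opposite_edge:
  assumes i: "v < n" "a < n" "b < n" "c < n" "distinct [v, a, b, c]"
    and F: "F \<in> components (S2 - (E {v, a} \<union> E {v, b} \<union> E {v, c} \<union> E {a, b} \<union> E {a, c} \<union> E {b, c}))"
    and x: "x \<in> closure F" "x \<in> E {v, a}" "x \<noteq> p v" "x \<noteq> p a"
  obtains y where "y \<in> closure F" "y \<in> E {v, a} - {p v, p a}" "y \<notin> E {b, c}"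
proof (cases "x \<in> E {b, c}")
  case True
  \<comment> \<open>The two end vertices are included so that the new contact point is not one of them.\<close>
  define T where "T = E {v, b} \<union> E {v, c} \<union> E {a, b} \<union> E {a, c} \<union> {p v, p a}"
  have cl: "closed (E {j, k})" if "j < n" "k < n" "j \<noteq> k" for j k
    using edge_arc_between[OF that] arc_between_compact compact_imp_closed by blast
  have "crosses_at (E {v, a}) (E {b, c}) x"
  proof -
    have "p ` {v, a} \<inter> p ` {b, c} = {}"
      using vertices_distinct i by (auto simp: inj_on_eq_iff)
    moreover have "{v, a} \<noteq> {b, c}" using i by (auto simp: doubleton_eq_iff)
    ultimately show ?thesis
      using intersection_kind[OF edge_in_K[of v a] edge_in_K[of b c], of x] i x True by auto
  qed
  moreover have "closed T" unfolding T_def by (intro closed_Un cl closed_insert closed_empty) (use i in auto)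
  moreover have "x \<notin> T"
    using adjacent_edges_meet[of v a b] adjacent_edges_meet[of v a c]
      adjacent_edges_meet[of a v b] adjacent_edges_meet[of a v c] i x
    unfolding T_def by (auto simp: insert_commute)
  moreover have "E {v, a} \<union> E {v, b} \<union> E {v, c} \<union> E {a, b} \<union> E {a, c} \<union> E {b, c} = E {v, a} \<union> E {b, c} \<union> T"
    using arc_between_ends[OF edge_arc_between[of v a]] i unfolding T_def by auto
  then have "F \<in> components (S2 - (E {v, a} \<union> E {b, c} \<union> T))" using F by simp
  ultimately obtain y where "y \<in> closure F" "y \<in> E {v, a}" "y \<notin> E {b, c}" "y \<notin> T"
    using crossing_point_touches_arc_elsewhere x(1) by blast
  then show ?thesis using that unfolding T_def by blast
next
  case False
  then show ?thesis using that x by blast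
qed

text \<open>
  There are three pairs consisting of a spoke at \<open>v\<close> and its opposite edge. This is the case that
  two of them are alike, both meeting or both disjoint.
\<close>
lemma K4_face_misses_a_spoke_if_opposite_pairs_agree:
  assumes i: "v < n" "a < n" "b < n" "c < n" "distinct [v, a, b, c]"
    and agree: "E {v, a} \<inter> E {b, c} = {} \<longleftrightarrow> E {v, b} \<inter> E {a, c} = {}"
    and F: "F \<subseteq> S2" "connected F" "F \<inter> (E {v, a} \<union> E {v, b} \<union> E {v, c} \<union> E {b, c} \<union> E {a, c}) = {}"
    and P: "P \<in> closure F" "P \<in> E {v, a} - {p v, p a}" "P \<notin> E {b, c}"
    and Q: "Q \<in> closure F" "Q \<in> E {v, b} - {p v, p b}" "Q \<notin> E {a, c}"
    and R: "R \<in> closure F" "R \<in> E {v, c} - {p v, p c}"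
  shows False
proof (rule K4_face_misses_a_spoke[where A = "E {v, a}" and B = "E {v, b}" and C = "E {v, c}"
      and X = "E {b, c}" and Y = "E {a, c}"])
  have "{v, a} \<noteq> {b, c}" "{v, b} \<noteq> {a, c}" using i by (auto simp: doubleton_eq_iff)
  then show "E {v, a} \<inter> E {b, c} = {} \<and> E {v, b} \<inter> E {a, c} = {} \<or>
      (\<exists>x y. E {v, a} \<inter> E {b, c} = {x} \<and> E {v, b} \<inter> E {a, c} = {y})"
    using agree edges_meet_at_most_once[of "{v, a}" "{b, c}"] edges_meet_at_most_once[of "{v, b}" "{a, c}"]
      edge_in_K i by auto
  show "E {v, a} \<inter> E {a, c} = {p a}" "E {v, b} \<inter> E {b, c} = {p b}" "E {v, c} \<inter> E {b, c} = {p c}"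
    "E {v, c} \<inter> E {a, c} = {p c}" "E {b, c} \<inter> E {a, c} = {p c}"
    using adjacent_edges_meet[of a v c] adjacent_edges_meet[of b v c] adjacent_edges_meet[of c v b]
      adjacent_edges_meet[of c v a] adjacent_edges_meet[of c b a] i
    by (simp_all add: insert_commute)
qed (use assms edge_arc_between adjacent_edges_meet edges_on_sphere edge_in_K in auto)

text \<open>
  Among the three pairs of a spoke and its opposite edge, two are always alike, since a pair
  either meets or does not. The contact points are first moved off the opposite edges.
\<close>
lemma K4_face_touches_at_most_two_spokes:
  assumes i: "v < n" "a < n" "b < n" "c < n" "distinct [v, a, b, c]"
    and F: "F \<in> components (S2 - (E {v, a} \<union> E {v, b} \<union> E {v, c} \<union> E {a, b} \<union> E {a, c} \<union> E {b, c}))"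
    and touch: "closure F \<inter> (E {v, a} - {p v, p a}) \<noteq> {}" "closure F \<inter> (E {v, b} - {p v, p b}) \<noteq> {}"
      "closure F \<inter> (E {v, c} - {p v, p c}) \<noteq> {}"
  shows False
proof -
  obtain P where P: "P \<in> closure F" "P \<in> E {v, a} - {p v, p a}" "P \<notin> E {b, c}"
    using touch(1) face_touches_edge_off_opposite_edge[OF i F] by blast
  obtain Q where Q: "Q \<in> closure F" "Q \<in> E {v, b} - {p v, p b}" "Q \<notin> E {a, c}"
    using touch(2) face_touches_edge_off_opposite_edge[of v b a c F] i F
    by (auto simp: insert_commute Un_ac)
  obtain R where R: "R \<in> closure F" "R \<in> E {v, c} - {p v, p c}" "R \<notin> E {a, b}"
    using touch(3) face_touches_edge_off_opposite_edge[of v c a b F] i F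
    by (auto simp: insert_commute Un_ac)
  have F': "F \<subseteq> S2" "connected F"
    "F \<inter> (E {v, a} \<union> E {v, b} \<union> E {v, c} \<union> E {a, b} \<union> E {a, c} \<union> E {b, c}) = {}"
    using in_components_subset[OF F] in_components_connected[OF F] by auto
  let ?a = "E {v, a} \<inter> E {b, c} = {}" and ?b = "E {v, b} \<inter> E {a, c} = {}" and ?c = "E {v, c} \<inter> E {a, b} = {}"
  consider "?a \<longleftrightarrow> ?b" | "?a \<longleftrightarrow> ?c" | "?b \<longleftrightarrow> ?c" by blast
  then show False
  proof cases
    case 1
    then show False
      using K4_face_misses_a_spoke_if_opposite_pairs_agree[of v a b c F P Q R] i F' P Q R by auto
  next
    case 2
    then show False
      using K4_face_misses_a_spoke_if_opposite_pairs_agree[of v a c b F P R Q] i F' P Q R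
      by (auto simp: insert_commute)
  next
    case 3
    then show False
      using K4_face_misses_a_spoke_if_opposite_pairs_agree[of v b c a F Q R P] i F' P Q R
      by (auto simp: insert_commute)
  qed
qed

lemma open_edge_at_vertex:
  assumes "e \<in> open_edges_at n p E v"
  obtains w where "w < n" "w \<noteq> v" "e = E {v, w} - {p v, p w}"
proof -
  obtain a where a: "a \<subseteq> {..<n}" "card a = 2" "v \<in> a" "e = open_edge p E a"
    using assms unfolding open_edges_at_def K_edges_def by auto
  then obtain w where "a = {v, w}" "w \<noteq> v" by (auto simp: card_2_iff)
  with a show thesis using that unfolding open_edge_def by auto
qed

end

section \<open>Faces and the edges at a vertex\<close>

theorem theorem3:
  fixes n v :: nat
    and p :: "nat \<Rightarrow> real^3"
    and E :: "nat set \<Rightarrow> (real^3) set"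
    and F C e1 e2 e3 :: "(real^3) set"
  assumes "n \<ge> 4"
    and "simple_drawing n p E"
    and "F \<in> faces n p E"
    and "C = face_boundary F"
    and "v < n"
    and "e1 \<in> open_edges_at n p E v"
    and "e2 \<in> open_edges_at n p E v"
    and "e3 \<in> open_edges_at n p E v"
    and "e1 \<noteq> e2" "e1 \<noteq> e3" "e2 \<noteq> e3"
  shows "C \<inter> e1 = {} \<or> C \<inter> e2 = {} \<or> C \<inter> e3 = {}"
proof (rule ccontr)
  assume meets: "\<not> ?thesis"
  interpret simple_drawing n p E by (rule assms(2))
  obtain a where a: "a < n" "a \<noteq> v" "e1 = E {v, a} - {p v, p a}"
    using open_edge_at_vertex[OF assms(6)] .
  obtain b where b: "b < n" "b \<noteq> v" "e2 = E {v, b} - {p v, p b}"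
    using open_edge_at_vertex[OF assms(7)] .
  obtain c where c: "c < n" "c \<noteq> v" "e3 = E {v, c} - {p v, p c}"
    using open_edge_at_vertex[OF assms(8)] .
  have i: "v < n" "a < n" "b < n" "c < n" "distinct [v, a, b, c]"
    using assms(5,9-11) a b c by auto
  let ?K4 = "E {v, a} \<union> E {v, b} \<union> E {v, c} \<union> E {a, b} \<union> E {a, c} \<union> E {b, c}"
  have F: "F \<in> components (S2 - drawing_set n p E)" using assms(3) unfolding faces_def .
  have "?K4 \<subseteq> drawing_set n p E"
    unfolding drawing_set_def using i edge_in_K by auto
  then have "F \<subseteq> S2 - ?K4" using in_components_subset[OF F] by blast
  then obtain G where G: "G \<in> components (S2 - ?K4)" "F \<subseteq> G"
    using exists_component_superset[of F "S2 - ?K4"] in_components_nonempty[OF F] in_components_connected[OF F]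
    by (metis subset_empty)
  have "C \<subseteq> closure F"
    unfolding assms(4) face_boundary_def frontier_of_def closure_of_subtopology
    using closure_mono[of "S2 \<inter> F" F] by auto
  then have "C \<subseteq> closure G" using closure_mono[OF G(2)] by blast
  then show False
    using K4_face_touches_at_most_two_spokes[OF i G(1)] meets a b c by blast
qed

end
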